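(* Let $S=\mathbb{C}[x_1,x_2,\ldots,x_n]$ with $n\geq 2$, and let $a,d$ be positive integers. For each positive integer $m$ let $p_m(n)=x_1^m+x_2^m+\cdots+x_n^m\in S$. Assume that $\gcd(a,d)=1$ and that $n!$ divides $a(a+d)(a+2d)\cdots(a+(n-1)d)$. Then the sequence $$p_a(n),\ p_{a+d}(n),\ p_{a+2d}(n),\ \ldots,\ p_{a+(n-1)d}(n)$$ is a regular sequence in $S$.
   Context: A sequence $f_1,\ldots,f_n$ in a commutative ring $S$ is a regular sequence if $(f_1,\ldots,f_n)\neq S$ and, for each $i=1,\ldots,n$, the element $f_i$ is a non-zero-divisor on $S/(f_1,\ldots,f_{i-1})$. *)

theory Defs
  imports Complex_Main "HOL-Library.Poly_Mapping" "HOL-Library.Cardinality"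
begin

text \<open>
  For a finite index type \<open>'n\<close>, the type \<open>('n, 'a) mpoly_ring\<close> is the polynomial ring over \<open>'a\<close> in
  variables \<open>x\<^sub>i\<close>, \<open>i :: 'n\<close>: a polynomial is a finitely supported coefficient function on the
  exponent vectors \<open>'n \<Rightarrow>\<^sub>0 nat\<close>, and \<open>Poly_Mapping\<close> supplies the convolution product.
\<close>

type_synonym ('n, 'a) mpoly_ring = "('n \<Rightarrow>\<^sub>0 nat) \<Rightarrow>\<^sub>0 'a"

definition var :: "'n \<Rightarrow> ('n, 'a::comm_ring_1) mpoly_ring" where
  "var i = Poly_Mapping.single (Poly_Mapping.single i 1) 1"

definition power_sum :: "nat \<Rightarrow> ('n::finite, 'a::comm_ring_1) mpoly_ring" where
  "power_sum m = (\<Sum>i\<in>UNIV. var i ^ m)"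

text \<open>The ideal generated by a set is its span in the ring regarded as a module over itself.\<close>

definition ideal_gen :: "'a::comm_ring_1 set \<Rightarrow> 'a set" where
  "ideal_gen = module.span (*)"

lemma module_times: "module ((*) :: 'a::comm_ring_1 \<Rightarrow> 'a \<Rightarrow> 'a)"
  by unfold_locales (simp_all add: algebra_simps)

text \<open>
  A non-zero-divisor on the quotient by an ideal \<open>I\<close>: the product of the classes of \<open>f\<close> and \<open>g\<close>
  vanishes only if the class of \<open>g\<close> does, and the class of an element is zero exactly if the
  element lies in \<open>I\<close>.
\<close>

definition nonzerodivisor_mod :: "'a::comm_ring_1 set \<Rightarrow> 'a \<Rightarrow> bool" where
  "nonzerodivisor_mod I f \<longleftrightarrow> (\<forall>g. f * g \<in> I \<longrightarrow> g \<in> I)"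

text \<open>List positions start at 0, so \<open>take i fs\<close> lists exactly the predecessors of \<open>fs ! i\<close>.\<close>

definition regular_sequence :: "'a::comm_ring_1 list \<Rightarrow> bool" where
  "regular_sequence fs \<longleftrightarrow>
     ideal_gen (set fs) \<noteq> UNIV \<and>
     (\<forall>i<length fs. nonzerodivisor_mod (ideal_gen (set (take i fs))) (fs ! i))"

end

theory Submission
  imports Defs "HOL-Computational_Algebra.Computational_Algebra"
begin

text \<open>
  Write \<open>p\<^sub>k\<close> for the power sum with exponent \<open>a + k d\<close>. Every prime divisor of \<open>d\<close> exceeds \<open>n\<close>:
  a prime that is at most \<open>n\<close> divides \<open>n!\<close>, hence some factor \<open>a + k d\<close>, so if it divided \<open>d\<close> it
  would divide \<open>a\<close> as well.

  This makes the common zeros trivial. Suppose that \<open>m \<le> n\<close> field elements \<open>x\<^sub>j\<close> satisfy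
  \<open>\<Sum>\<^sub>j x\<^sub>j\<^sup>a (x\<^sub>j\<^sup>d)\<^sup>k = 0\<close> for all \<open>k < m\<close>. A Vandermonde argument in the nodes
  \<open>x\<^sub>j\<^sup>d\<close> (\<open>vandermonde_mod_prime\<close>) shows that already the sum of \<open>x\<^sub>j\<^sup>a\<close> over all \<open>j\<close> with a given
  value of \<open>x\<^sub>j\<^sup>d\<close> vanishes. These \<open>x\<^sub>j\<close> differ by \<open>d\<close>-th roots of unity, so either they are
  zero or at most \<open>n\<close> many \<open>d\<close>-th roots of unity add up to zero. The latter is impossible
  (\<open>sum_few_roots_of_unity_nonzero\<close>): all exponents from \<open>1\<close> to \<open>n\<close> are coprime to \<open>d\<close>, so by
  conjugation (\<open>conjugate_root_of_unity\<close>) the first \<open>n\<close> power sums of these roots would all vanish,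
  which a second use of the Vandermonde argument excludes. The argument works modulo
  every prime ideal of the polynomial ring. Since an element that lies in all primes above an ideal
  has a power in the ideal, it yields without the Nullstellensatz that each
  remaining variable has a power in the ideal generated by the first \<open>m\<close> power sums and all but \<open>m\<close>
  variables (\<open>var_power_in_power_sum_ideal\<close>).

  Passing from trivial zeros to regularity would in general require the unmixedness theorem for
  Cohen--Macaulay rings. Here it can be avoided, because setting a variable to zero gives
  power sums in fewer variables, so one can induct on the set \<open>U\<close> of variables that are not set to zero
  (\<open>power_sum_nonzerodivisor\<close>). When a variable \<open>x\<close> is added to \<open>U\<close>, the sequence \<open>x, p\<^sub>0, p\<^sub>1, \<dots>\<close> with
  as many power sums as \<open>U\<close> has elements is regular modulo the variables still set to zero, by the
  induction hypothesis. Homogeneity allows \<open>x\<close> to be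
  moved past the power sums one at a time (\<open>swap_nonzerodivisors\<close>). At the end of the sequence, \<open>x\<close>
  can be exchanged for the last power sum, since that power sum divides a
  power of \<open>x\<close> modulo the preceding ones (\<open>nonzerodivisor_mod_if_divides_power\<close>).
\<close>

section \<open>Conjugates of roots of unity\<close>

definition ipoly :: "int poly \<Rightarrow> complex \<Rightarrow> complex" where
  "ipoly f z = poly (map_poly of_int f) z"

lemma ipoly_0 [simp]: "ipoly 0 z = 0"
  by (simp add: ipoly_def)

lemma ipoly_pCons [simp]: "ipoly (pCons a f) z = of_int a + z * ipoly f z"
  by (simp add: ipoly_def map_poly_pCons)

lemma ipoly_add [simp]: "ipoly (f + g) z = ipoly f z + ipoly g z"
  by (induction f g rule: poly_induct2) (simp_all add: algebra_simps)

lemma ipoly_smult [simp]: "ipoly (smult c f) z = of_int c * ipoly f z"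
  by (induction f) (simp_all add: algebra_simps)

lemma ipoly_mult [simp]: "ipoly (f * g) z = ipoly f z * ipoly g z"
  by (induction f) (simp_all add: algebra_simps)

lemma ipoly_1 [simp]: "ipoly 1 z = 1"
  by (simp add: one_pCons)

lemma ipoly_minus [simp]: "ipoly (- f) z = - ipoly f z"
  using ipoly_smult[of "-1" f z] by simp

lemma ipoly_diff [simp]: "ipoly (f - g) z = ipoly f z - ipoly g z"
  using ipoly_add[of f "- g" z] by simp

lemma ipoly_power [simp]: "ipoly (f ^ k) z = ipoly f z ^ k"
  by (induction k) simp_all

lemma ipoly_monom [simp]: "ipoly (monom c k) z = of_int c * z ^ k"
  by (induction k) (simp_all add: monom_0 monom_Suc)

lemma ipoly_sum [simp]: "ipoly (\<Sum>j\<in>A. f j) z = (\<Sum>j\<in>A. ipoly (f j) z)"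
  by (induction A rule: infinite_finite_induct) simp_all

lemma ipoly_pcompose [simp]: "ipoly (pcompose f g) z = ipoly f (ipoly g z)"
  by (induction f) (simp_all add: pcompose_pCons)

text \<open>Stated with divisibility by \<open>of_nat q\<close> instead of characteristic \<open>q\<close>, so that it applies to \<open>int\<close> and
  \<open>int poly\<close> and makes the quotient available for evaluation at \<open>\<zeta>\<close>.\<close>

lemma prime_dvd_power_add_diff:
  fixes x y :: "'a::comm_ring_1"
  assumes "prime q"
  shows "of_nat q dvd (x + y) ^ q - (x ^ q + y ^ q)"
proof -
  have q: "q > 0" using assms prime_gt_0_nat by auto
  have eq: "{..q} = insert 0 (insert q {1..<q})" using q by auto
  have "(x + y) ^ q = (\<Sum>k\<in>{..q}. of_nat (q choose k) * x ^ k * y ^ (q - k))"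
    by (rule binomial_ring)
  also have "\<dots> = x ^ q + y ^ q + (\<Sum>k=1..<q. of_nat (q choose k) * x ^ k * y ^ (q - k))"
    unfolding eq using q by (simp add: add_ac)
  finally have "(x + y) ^ q - (x ^ q + y ^ q) = (\<Sum>k=1..<q. of_nat (q choose k) * x ^ k * y ^ (q - k))"
    by simp
  also have "of_nat q dvd \<dots>"
  proof (rule dvd_sum)
    fix k assume k: "k \<in> {1..<q}"
    have "q dvd (q choose k)"
      using k assms by (intro dvd_choose_prime) auto
    then obtain m where m: "q choose k = q * m" by (rule dvdE)
    show "of_nat q dvd (of_nat (q choose k) * x ^ k * y ^ (q - k) :: 'a)"
      unfolding m by (simp add: mult.assoc)
  qed
  finally show ?thesis .
qed

lemma fermat_int:
  fixes a :: int
  assumes "prime q"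
  shows "int q dvd a ^ q - a"
proof (induction a rule: int_induct[where k = 0])
  case base
  then show ?case using prime_gt_0_nat[OF assms] by (simp add: power_0_left)
next
  case (step1 i)
  have "int q dvd ((i + 1) ^ q - (i ^ q + 1 ^ q)) + (i ^ q - i)"
    using prime_dvd_power_add_diff[OF assms, of i 1] step1.IH by (intro dvd_add) simp_all
  moreover have "((i + 1) ^ q - (i ^ q + 1 ^ q)) + (i ^ q - i) = (i + 1) ^ q - (i + 1)"
    by simp
  ultimately show ?case by metis
next
  case (step2 i)
  have "int q dvd (i ^ q - i) - ((i - 1 + 1) ^ q - ((i - 1) ^ q + 1 ^ q))"
    using prime_dvd_power_add_diff[OF assms, of "i - 1" 1] step2.IH by (intro dvd_diff[of _ "i ^ q - i"]) simp_all
  moreover have "(i ^ q - i) - ((i - 1 + 1) ^ q - ((i - 1) ^ q + 1 ^ q)) = (i - 1) ^ q - (i - 1)"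
    by simp
  ultimately show ?case by metis
qed

lemma int_poly_frobenius:
  fixes f :: "int poly"
  assumes "prime q"
  shows "of_nat q dvd f ^ q - pcompose f (monom 1 q)"
proof (induction f)
  case 0
  then show ?case using prime_gt_0_nat[OF assms] by (simp add: power_0_left)
next
  case (pCons a f)
  let ?X = "monom 1 1 :: int poly"
  have X: "pCons a f = [:a:] + ?X * f" by (simp add: monom_Suc monom_0)
  have 1: "of_nat q dvd (pCons a f) ^ q - ([:a:] ^ q + (?X * f) ^ q)"
    unfolding X by (rule prime_dvd_power_add_diff[OF assms])
  have "[:a:] ^ q = [:a ^ q:]" by (metis poly_const_pow)
  moreover have "of_nat q dvd ([:a ^ q:] - [:a:])"
    using fermat_int[OF assms, of a] by (simp add: of_nat_poly)
  ultimately have 2: "of_nat q dvd [:a:] ^ q - [:a:]" by simp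
  have 3: "of_nat q dvd monom 1 q * (f ^ q - pcompose f (monom 1 q))"
    using pCons.IH by simp
  have "(?X * f) ^ q = monom 1 q * f ^ q"
    by (simp add: power_mult_distrib monom_power)
  then have "(pCons a f) ^ q - pcompose (pCons a f) (monom 1 q) =
     ((pCons a f) ^ q - ([:a:] ^ q + (?X * f) ^ q)) + ([:a:] ^ q - [:a:]) + monom 1 q * (f ^ q - pcompose f (monom 1 q))"
    by (simp add: pcompose_pCons algebra_simps)
  with 1 2 3 show ?case by (metis dvd_add)
qed

text \<open>Gauss's lemma: an integer polynomial of least degree vanishing at \<open>\<zeta>\<close>, made primitive, divides
  \<open>X ^ d - 1\<close> over the rationals by pseudo-division and hence over the integers. Its leading
  coefficient then divides \<open>1\<close>, so the ring generated by \<open>\<zeta>\<close> is free over the integers.\<close>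

lemma minimal_int_poly_of_root_of_unity:
  assumes "\<zeta> ^ d = 1" and "d > 0"
  obtains g k where "monom 1 d - 1 = g * k" and "ipoly g \<zeta> = 0" and "lead_coeff g dvd 1"
    and "degree g > 0" and "\<And>f. f \<noteq> 0 \<Longrightarrow> ipoly f \<zeta> = 0 \<Longrightarrow> degree g \<le> degree f"
proof -
  define r :: "int poly" where "r = arg_min degree (\<lambda>f. f \<noteq> 0 \<and> ipoly f \<zeta> = 0)"
  define u where "u = (monom 1 d - 1 :: int poly)"
  have lu: "coeff u d = 1" using assms by (simp add: u_def)
  then have u0: "u \<noteq> 0" by auto
  have cu: "content u = 1"
    by (metis content_dvd_coeff is_unit_content_iff lu)
  have uz: "ipoly u \<zeta> = 0" using assms by (simp add: u_def)
  have r: "r \<noteq> 0 \<and> ipoly r \<zeta> = 0" unfolding r_def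
    by (rule arg_min_natI[of _ u]) (use u0 uz in auto)
  have rmin: "degree r \<le> degree f" if "f \<noteq> 0" "ipoly f \<zeta> = 0" for f
    unfolding r_def by (rule arg_min_nat_le) (use that in auto)
  define g where "g = primitive_part r"
  have g0: "g \<noteq> 0" using r by (simp add: g_def)
  have cg: "content g = 1" using r by (simp add: g_def)
  have dg: "degree g = degree r" by (simp add: g_def)
  have "ipoly r \<zeta> = of_int (content r) * ipoly g \<zeta>"
    by (metis g_def content_times_primitive_part ipoly_smult)
  then have gz: "ipoly g \<zeta> = 0" using r by simp
  obtain s t where st: "pseudo_divmod u g = (s, t)" by force
  define c where "c = lead_coeff g ^ (Suc (degree u) - degree g)"
  have c: "smult c u = g * s + t" "t = 0 \<or> degree t < degree g"
    using pseudo_divmod[OF g0 st] by (auto simp: c_def)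
  have c0: "c \<noteq> 0" using g0 by (simp add: c_def)
  have "ipoly t \<zeta> = 0" using arg_cong[OF c(1), of "\<lambda>f. ipoly f \<zeta>"] uz gz by simp
  then have "t = 0" using c(2) rmin[of t] dg by fastforce
  with c have cs: "smult c u = g * s" by simp
  then have "primitive_part (smult c u) = primitive_part (g * s)" by simp
  then have "smult (unit_factor c) u = g * primitive_part s"
    by (simp add: primitive_part_smult primitive_part_mult primitive_part_prim cu cg)
  \<comment> \<open>The unit factor is a sign, so applying it twice cancels it.\<close>
  then have "smult (unit_factor c) (smult (unit_factor c) u) = g * smult (unit_factor c) (primitive_part s)"
    by simp
  then have uk: "u = g * smult (unit_factor c) (primitive_part s)"
    using c0 by (auto simp: sgn_if split: if_splits)
  have "degree u = d"
  proof (rule antisym)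
    show "degree u \<le> d" unfolding u_def by (intro degree_diff_le degree_monom_le) simp
    show "d \<le> degree u" by (rule le_degree) (simp add: lu)
  qed
  then have "lead_coeff u = 1" using lu by simp
  then have lg: "lead_coeff g dvd 1" using uk by (metis dvd_triv_left lead_coeff_mult)
  have "degree g > 0"
  proof (rule ccontr)
    assume "\<not> degree g > 0"
    then obtain a where "g = [:a:]" by (metis degree_0_id degree_eq_zeroE gr0I)
    with g0 gz show False by simp
  qed
  with that[of g] uk gz lg rmin dg show thesis unfolding u_def by metis
qed

text \<open>The powers of \<open>\<zeta>\<close> below the degree of its minimal polynomial form a basis of the ring generated by
  \<open>\<zeta>\<close>, and \<open>1\<close> is one of them. Comparing the constant terms of both sides in this basis gives the claim.\<close>

lemma int_dvd_if_multiple_in_cyclotomic_integers: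
  assumes "\<zeta> ^ d = 1" and "d > 0" and "of_int c = of_int q * ipoly h \<zeta>"
  shows "q dvd c"
proof -
  obtain g k where g: "ipoly g \<zeta> = 0" "lead_coeff g dvd 1" "degree g > 0"
    "\<And>f. f \<noteq> 0 \<Longrightarrow> ipoly f \<zeta> = 0 \<Longrightarrow> degree g \<le> degree f"
    using minimal_int_poly_of_root_of_unity[OF assms(1,2)] by metis
  obtain s t where st: "pseudo_divmod h g = (s, t)" by force
  define e where "e = lead_coeff g ^ (Suc (degree h) - degree g)"
  have g0: "g \<noteq> 0" using g by auto
  have e: "smult e h = g * s + t" "t = 0 \<or> degree t < degree g"
    using pseudo_divmod[OF g0 st] by (auto simp: e_def)
  have "ipoly t \<zeta> = of_int e * ipoly h \<zeta>"
    using arg_cong[OF e(1), of "\<lambda>f. ipoly f \<zeta>"] g by simp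
  \<comment> \<open>The remainder \<open>t\<close> represents \<open>e h(\<zeta>)\<close> in degree below that of \<open>g\<close>, where minimality makes
    representations unique; \<open>e\<close> is a unit.\<close>
  then have "ipoly ([:e * c:] - smult q t) \<zeta> = 0" using assms(3) by simp
  moreover have "degree ([:e * c:] - smult q t) < degree g"
    using e(2) g(3) by (intro degree_diff_less) (auto intro: le_less_trans[OF degree_smult_le])
  ultimately have "[:e * c:] - smult q t = 0"
    using g(4)[of "[:e * c:] - smult q t"] by (metis not_le)
  then have "coeff ([:e * c:] - smult q t) 0 = 0" by simp
  then have "e * c = q * coeff t 0" by simp
  then have "q dvd e * c" by simp
  moreover have "e dvd 1" using g(2) unfolding e_def by (metis dvd_power_same power_one)
  ultimately show ?thesis using dvd_mult_unit_iff'[of e q c] by simp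
qed

text \<open>For the minimal polynomial \<open>g\<close> of \<open>\<zeta>\<close>, the Frobenius congruence makes \<open>g (\<zeta> ^ q)\<close> a multiple of \<open>q\<close>.
  If it were non-zero, then \<open>\<zeta> ^ q\<close> would be a root of the cofactor \<open>k\<close> in \<open>X ^ d - 1 = g k\<close>, and
  differentiating this equation at \<open>\<zeta> ^ q\<close> would show that \<open>g (\<zeta> ^ q)\<close> divides \<open>d\<close>; so \<open>q\<close> would
  divide \<open>d\<close>.\<close>

lemma conjugate_root_of_unity_prime:
  assumes "\<zeta> ^ d = 1" and "d > 0" and "prime q" and "\<not> q dvd d" and "ipoly f \<zeta> = 0"
  shows "ipoly f (\<zeta> ^ q) = 0"
proof -
  obtain g k where g: "monom 1 d - 1 = g * k" "ipoly g \<zeta> = 0"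
    "\<And>f. f \<noteq> 0 \<Longrightarrow> ipoly f \<zeta> = 0 \<Longrightarrow> degree g \<le> degree f" "degree g > 0"
    using minimal_int_poly_of_root_of_unity[OF assms(1,2)] by metis
  let ?w = "\<zeta> ^ q"
  have w: "?w ^ d = 1" using assms(1) by (metis power_mult mult.commute power_one)
  have gw: "ipoly g ?w = 0"
  proof (rule ccontr)
    assume nz: "ipoly g ?w \<noteq> 0"
    obtain v where v: "g ^ q - pcompose g (monom 1 q) = of_nat q * v"
      using int_poly_frobenius[OF assms(3), of g] by (rule dvdE)
    have qv: "- ipoly g ?w = of_nat q * ipoly v \<zeta>"
      using arg_cong[OF v, of "\<lambda>f. ipoly f \<zeta>"] g(2) prime_gt_0_nat[OF assms(3)]
      by (simp add: of_nat_poly power_0_left)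
    have "ipoly g ?w * ipoly k ?w = 0"
      using arg_cong[OF g(1), of "\<lambda>f. ipoly f ?w"] w by simp
    with nz have kw: "ipoly k ?w = 0" by simp
    have "pderiv (monom 1 d - 1) = pderiv (g * k)" using g(1) by simp
    then have "monom (int d) (d - 1) = g * pderiv k + pderiv g * k"
      by (simp add: pderiv_diff pderiv_mult pderiv_monom algebra_simps)
    from arg_cong[OF this, of "\<lambda>f. ipoly f ?w"]
    have "of_nat d * ?w ^ (d - 1) = ipoly g ?w * ipoly (pderiv k) ?w" using kw by simp
    \<comment> \<open>Multiplying by \<open>?w\<close> turns the unit \<open>?w ^ (d - 1)\<close> into \<open>1\<close>.\<close>
    then have "of_nat d * (?w ^ (d - 1) * ?w) = - (- ipoly g ?w) * (ipoly (pderiv k) ?w * ?w)" by simp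
    moreover have "?w ^ (d - 1) * ?w = 1"
      using w assms(2) by (metis power_minus_mult)
    ultimately have "of_int (int d) = of_int (int q) * ipoly (- v * (pcompose (pderiv k) (monom 1 q) * monom 1 q)) \<zeta>"
      unfolding qv by (simp add: mult.assoc)
    then have "int q dvd int d" by (rule int_dvd_if_multiple_in_cyclotomic_integers[OF assms(1,2)])
    with assms(4) show False by simp
  qed
  show ?thesis
  proof -
    have g0: "g \<noteq> 0" using g(4) by auto
    obtain s t where st: "pseudo_divmod f g = (s, t)" by force
    define c where "c = lead_coeff g ^ (Suc (degree f) - degree g)"
    have c: "smult c f = g * s + t" "t = 0 \<or> degree t < degree g"
      using pseudo_divmod[OF g0 st] by (auto simp: c_def)
    have c0: "c \<noteq> 0" using g0 by (simp add: c_def)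
    have "ipoly t \<zeta> = 0" using arg_cong[OF c(1), of "\<lambda>f. ipoly f \<zeta>"] g(2) assms(5) by simp
    then have "t = 0" using c(2) g(3)[of t] by fastforce
    then show ?thesis using arg_cong[OF c(1), of "\<lambda>f. ipoly f ?w"] gw c0 by simp
  qed
qed

lemma conjugate_root_of_unity:
  assumes "\<zeta> ^ d = 1" and "d > 0" and "m > 0" and "coprime m d" and "ipoly f \<zeta> = 0"
  shows "ipoly f (\<zeta> ^ m) = 0"
  using assms(3,4)
proof (induction m rule: prime_divisors_induct)
  case zero
  then show ?case by simp
next
  case (unit m)
  then have "m = 1" by simp
  then show ?case using assms(5) by simp
next
  case (factor p m)
  from factor.prems have m: "m > 0" "coprime m d" and p: "\<not> p dvd d"
    using factor.hyps by (auto simp: prime_imp_coprime_nat prime_nat_iff coprime_absorb_left)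
  have "(\<zeta> ^ m) ^ d = 1" using assms(1) by (metis power_mult mult.commute power_one)
  from conjugate_root_of_unity_prime[OF this assms(2) factor.hyps(1) p factor.IH[OF m]]
  show ?case by (simp add: mult.commute flip: power_mult)
qed

section \<open>Ideals, prime ideals and Vandermonde systems\<close>

global_interpretation ideal: module "(*) :: 'a::comm_ring_1 \<Rightarrow> 'a \<Rightarrow> 'a"
  rewrites "module.span (*) = ideal_gen"
  by (fact module_times) (simp add: ideal_gen_def)

text \<open>For multiplication as scaling this rule regroups products to the left and loops with \<open>mult_ac\<close>.\<close>

declare ideal.scale_scale [simp del]

lemma ideal_mult_right: "ideal.subspace I \<Longrightarrow> x \<in> I \<Longrightarrow> x * r \<in> I"
  by (metis ideal.subspace_scale mult.commute)

lemma ideal_congD: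
  assumes "ideal.subspace I" "x - y \<in> I"
  shows "x \<in> I \<longleftrightarrow> y \<in> I"
  using ideal.subspace_add[OF assms(1,2), of y] ideal.subspace_diff[OF assms(1) _ assms(2), of x] by auto

definition prime_ideal :: "'a::comm_ring_1 set \<Rightarrow> bool" where
  "prime_ideal P \<longleftrightarrow> ideal.subspace P \<and> 1 \<notin> P \<and> (\<forall>a b. a * b \<in> P \<longrightarrow> a \<in> P \<or> b \<in> P)"

lemma prime_ideal_power: "prime_ideal P \<Longrightarrow> x ^ k \<in> P \<Longrightarrow> x \<in> P"
  by (induction k) (auto simp: prime_ideal_def)

lemma prime_ideal_prod:
  assumes "prime_ideal P" "(\<Prod>j\<in>A. f j) \<in> P"
  shows "\<exists>j\<in>A. f j \<in> P"
  using assms(2)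
proof (induction A rule: infinite_finite_induct)
  case (insert j A)
  then show ?case using assms(1) by (auto simp: prime_ideal_def)
qed (use assms(1) in \<open>auto simp: prime_ideal_def\<close>)

text \<open>By Zorn's lemma there is an ideal \<open>M\<close> above \<open>J\<close> that is maximal among those containing no power of
  \<open>x\<close>. If neither \<open>a\<close> nor \<open>b\<close> lies in \<open>M\<close>, then some powers of \<open>x\<close> are congruent modulo \<open>M\<close> to
  multiples of \<open>a\<close> and of \<open>b\<close>, and their product shows that \<open>a b\<close> is not in \<open>M\<close> either.\<close>

lemma exists_prime_ideal_avoiding_powers:
  assumes J: "ideal.subspace J" and x: "\<And>k. x ^ k \<notin> J"
  obtains P where "prime_ideal P" "J \<subseteq> P" "x \<notin> P"
proof -
  define \<A> where "\<A> = {I. ideal.subspace I \<and> J \<subseteq> I \<and> (\<forall>k. x ^ k \<notin> I)}"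
  have "\<exists>M\<in>\<A>. \<forall>X\<in>\<A>. M \<subseteq> X \<longrightarrow> X = M"
  proof (rule subset_Zorn_nonempty)
    show "\<A> \<noteq> {}" using J x by (auto simp: \<A>_def)
    fix \<C> assume ne: "\<C> \<noteq> {}" and ch: "subset.chain \<A> \<C>"
    then have C: "\<And>I. I \<in> \<C> \<Longrightarrow> ideal.subspace I" "\<And>I. I \<in> \<C> \<Longrightarrow> J \<subseteq> I"
      "\<And>I k. I \<in> \<C> \<Longrightarrow> x ^ k \<notin> I"
      by (auto simp: subset.chain_def \<A>_def)
    have tot: "I \<subseteq> I' \<or> I' \<subseteq> I" if "I \<in> \<C>" "I' \<in> \<C>" for I I'
      using ch that by (auto simp: subset.chain_def)
    have "ideal.subspace (\<Union>\<C>)"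
    proof (rule ideal.subspaceI)
      show "0 \<in> \<Union>\<C>" using ne C(1) ideal.subspace_0 by blast
    next
      fix u v assume "u \<in> \<Union>\<C>" "v \<in> \<Union>\<C>"
      then obtain I I' where I: "I \<in> \<C>" "I' \<in> \<C>" "u \<in> I" "v \<in> I'" by blast
      from tot[OF I(1,2)] show "u + v \<in> \<Union>\<C>"
      proof
        assume "I \<subseteq> I'"
        then have "u + v \<in> I'" using I C(1) by (auto intro: ideal.subspace_add)
        then show ?thesis using I by blast
      next
        assume "I' \<subseteq> I"
        then have "u + v \<in> I" using I C(1) by (auto intro: ideal.subspace_add)
        then show ?thesis using I by blast
      qed
    next
      fix c u assume "u \<in> \<Union>\<C>"
      then show "c * u \<in> \<Union>\<C>" using C(1) ideal.subspace_scale by blast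
    qed
    moreover have "J \<subseteq> \<Union>\<C>" using ne C(2) by blast
    ultimately show "\<Union>\<C> \<in> \<A>" using C(3) by (auto simp: \<A>_def)
  qed
  then obtain M where M: "M \<in> \<A>" and max: "\<And>X. X \<in> \<A> \<Longrightarrow> M \<subseteq> X \<Longrightarrow> X = M" by blast
  have sM: "ideal.subspace M" and JM: "J \<subseteq> M" and xM: "\<And>k. x ^ k \<notin> M"
    using M by (auto simp: \<A>_def)
  have spM: "ideal_gen M = M" using sM by (simp add: ideal.span_eq_iff)
  have ext: "\<exists>k r. x ^ k - r * a \<in> M" if "a \<notin> M" for a
  proof -
    have "ideal_gen (insert a M) \<noteq> M" using that ideal.span_base[of a "insert a M"] by auto
    moreover have "M \<subseteq> ideal_gen (insert a M)" using ideal.span_superset[of "insert a M"] by blast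
    ultimately have "ideal_gen (insert a M) \<notin> \<A>" using max by blast
    then obtain k where "x ^ k \<in> ideal_gen (insert a M)"
      using JM \<open>M \<subseteq> ideal_gen (insert a M)\<close> ideal.subspace_span[of "insert a M"] by (auto simp: \<A>_def)
    then show ?thesis by (auto simp: ideal.span_breakdown_eq spM)
  qed
  have "a \<in> M \<or> b \<in> M" if ab: "a * b \<in> M" for a b
  proof (rule ccontr)
    assume "\<not> (a \<in> M \<or> b \<in> M)"
    then obtain k r l s where kr: "x ^ k - r * a \<in> M" and ls: "x ^ l - s * b \<in> M"
      using ext by metis
    have "x ^ l * (x ^ k - r * a) + (r * a) * (x ^ l - s * b) + (r * s) * (a * b) \<in> M"
      by (intro ideal.subspace_add[OF sM] ideal.subspace_scale[OF sM] kr ls ab)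
    then have "x ^ (k + l) \<in> M" by (simp add: algebra_simps power_add)
    then show False using xM by blast
  qed
  moreover have "1 \<notin> M" "x \<notin> M" using xM[of 0] xM[of 1] by auto
  ultimately show thesis using that[of M] sM JM by (auto simp: prime_ideal_def)
qed

text \<open>Modulo \<open>G\<close> the power \<open>x ^ N\<close> is a multiple of \<open>f\<close>, and a divisor of a non-zero-divisor is a
  non-zero-divisor.\<close>

lemma nonzerodivisor_mod_if_divides_power:
  assumes x: "nonzerodivisor_mod (ideal_gen G) x" and N: "x ^ N \<in> ideal_gen (insert f G)"
  shows "nonzerodivisor_mod (ideal_gen G) f"
  unfolding nonzerodivisor_mod_def
proof (intro allI impI)
  fix u assume fu: "f * u \<in> ideal_gen G"
  obtain r where r: "x ^ N - r * f \<in> ideal_gen G" using N by (auto simp: ideal.span_insert)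
  have "u * (x ^ N - r * f) + r * (f * u) \<in> ideal_gen G"
    by (rule ideal.span_add[OF ideal.span_scale[OF r] ideal.span_scale[OF fu]])
  then have "x ^ N * u \<in> ideal_gen G" by (simp add: algebra_simps)
  then show "u \<in> ideal_gen G"
  proof (induction N)
    case (Suc N)
    then show ?case using x by (simp add: nonzerodivisor_mod_def mult.assoc)
  qed simp
qed

lemma poly_diff_dvd:
  fixes f :: "'a::comm_ring_1 poly"
  shows "x - y dvd poly f x - poly f y"
proof (induction f)
  case (pCons a f)
  have "poly (pCons a f) x - poly (pCons a f) y = x * (poly f x - poly f y) + (x - y) * poly f y"
    by (simp add: algebra_simps)
  then show ?case using pCons.IH by simp
qed simp

text \<open>Solving a Vandermonde system whose nodes may coincide modulo \<open>P\<close>. Lagrange interpolation does it: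
  the polynomial \<open>Q\<close> that vanishes at all nodes not congruent to \<open>y i\<close> has degree less than \<open>card A\<close>, so
  \<open>\<Sum>\<^sub>j c\<^sub>j Q(y\<^sub>j)\<close> is in \<open>P\<close>. In this sum only the nodes congruent to \<open>y i\<close> remain, and
  their common factor \<open>Q(y\<^sub>i)\<close> can be cancelled because \<open>P\<close> is prime.\<close>

lemma vandermonde_mod_prime:
  fixes c y :: "'i \<Rightarrow> 'a::comm_ring_1"
  assumes P: "prime_ideal P" and A: "finite A" "i \<in> A"
    and c: "\<And>k. k < card A \<Longrightarrow> (\<Sum>j\<in>A. c j * y j ^ k) \<in> P"
  shows "(\<Sum>j | j \<in> A \<and> y j - y i \<in> P. c j) \<in> P"
proof -
  have sP: "ideal.subspace P" using P by (simp add: prime_ideal_def)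
  define D where "D = {j \<in> A. y j - y i \<notin> P}"
  define E where "E = {j \<in> A. y j - y i \<in> P}"
  define Q where "Q = (\<Prod>w\<in>D. [:- y w, 1:])"
  have fin: "finite D" "finite E" and AE: "A = E \<union> D" "E \<inter> D = {}" using A by (auto simp: D_def E_def)
  \<comment> \<open>The node \<open>y i\<close> itself is not a root of \<open>Q\<close>; this keeps the degree of \<open>Q\<close> below \<open>card A\<close>.\<close>
  have "i \<in> E" using A ideal.subspace_0[OF sP] by (simp add: E_def)
  then have cD: "card D < card A" using A AE by (intro psubset_card_mono) auto
  have "degree Q \<le> (\<Sum>w\<in>D. degree [:- y w, 1:])"
    unfolding Q_def using degree_prod_sum_le[OF fin(1), of "\<lambda>w. [:- y w, 1:]"] by (simp add: o_def)
  also have "\<dots> = card D" by simp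
  finally have dQ: "degree Q < card A" using cD by simp
  have "(\<Sum>j\<in>A. c j * poly Q (y j)) = (\<Sum>k\<le>degree Q. coeff Q k * (\<Sum>j\<in>A. c j * y j ^ k))"
    unfolding poly_altdef sum_distrib_left by (subst sum.swap) (simp add: mult_ac)
  also have "\<dots> \<in> P"
    using dQ by (intro ideal.subspace_sum[OF sP] ideal.subspace_scale[OF sP] c) auto
  finally have "(\<Sum>j\<in>A. c j * poly Q (y j)) \<in> P" .
  moreover have "(\<Sum>j\<in>D. c j * poly Q (y j)) \<in> P"
  proof (intro ideal.subspace_sum[OF sP] ideal.subspace_scale[OF sP])
    fix j assume "j \<in> D"
    then have "poly Q (y j) = 0" using fin(1) by (auto simp: Q_def poly_prod prod_zero_iff intro!: prod_zero bexI[of _ j])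
    then show "poly Q (y j) \<in> P" using ideal.subspace_0[OF sP] by simp
  qed
  ultimately have "(\<Sum>j\<in>E. c j * poly Q (y j)) \<in> P"
    using AE fin ideal.subspace_diff[OF sP] by (fastforce simp: sum.union_disjoint)
  moreover have "(\<Sum>j\<in>E. c j * poly Q (y j)) - (\<Sum>j\<in>E. c j) * poly Q (y i)
      = (\<Sum>j\<in>E. c j * (poly Q (y j) - poly Q (y i)))"
    by (simp add: sum_distrib_right sum_subtractf algebra_simps)
  moreover have "\<dots> \<in> P"
  proof (intro ideal.subspace_sum[OF sP] ideal.subspace_scale[OF sP])
    fix j assume "j \<in> E"
    obtain r where "poly Q (y j) - poly Q (y i) = (y j - y i) * r"
      using poly_diff_dvd[of "y j" "y i" Q] by (rule dvdE)
    then show "poly Q (y j) - poly Q (y i) \<in> P"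
      using \<open>j \<in> E\<close> ideal_mult_right[OF sP] by (simp add: E_def)
  qed
  ultimately have "(\<Sum>j\<in>E. c j) * poly Q (y i) \<in> P"
    using ideal_congD[OF sP] by metis
  moreover have "poly Q (y i) \<notin> P"
  proof
    assume "poly Q (y i) \<in> P"
    then obtain w where w: "w \<in> D" "y i - y w \<in> P"
      using prime_ideal_prod[OF P, of "\<lambda>w. y i - y w" D] by (auto simp: Q_def poly_prod)
    then have "y w - y i \<in> P" using ideal.subspace_neg[OF sP w(2)] by simp
    then show False using w(1) by (simp add: D_def)
  qed
  ultimately show ?thesis using P unfolding prime_ideal_def E_def by blast
qed

lemma power_diff_dvd: "x - y dvd x ^ k - (y :: 'a::comm_ring_1) ^ k"
  using poly_diff_dvd[of x y "monom 1 k"] by (simp add: poly_monom)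

section \<open>Short sums of roots of unity\<close>

text \<open>All \<open>m \<le> card A\<close> are coprime to \<open>d\<close>, so conjugation turns one vanishing sum into the vanishing of the
  first \<open>card A\<close> power sums of the \<open>z j\<close>. By the Vandermonde argument over the zero ideal,
  a positive multiple of \<open>z i\<close> would vanish.\<close>

lemma sum_few_roots_of_unity_nonzero:
  fixes z :: "'i \<Rightarrow> complex"
  assumes A: "finite A" "A \<noteq> {}" and d: "d > 0" and z: "\<And>j. j \<in> A \<Longrightarrow> z j ^ d = 1"
    and big: "\<And>p. prime p \<Longrightarrow> p dvd d \<Longrightarrow> card A < p"
  shows "(\<Sum>j\<in>A. z j) \<noteq> 0"
proof
  assume sum0: "(\<Sum>j\<in>A. z j) = 0"
  define \<zeta> where "\<zeta> = cis (2 * pi / d)"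
  have \<zeta>: "\<zeta> ^ d = 1" using d by (simp add: \<zeta>_def DeMoivre)
  have "\<exists>e. z j = \<zeta> ^ e" if "j \<in> A" for j
  proof -
    have "z j \<in> (\<lambda>k. cis (2 * pi * real k / real d)) ` {..<d}"
      using bij_betw_roots_unity[OF d] z[OF that] by (auto simp: bij_betw_def)
    then show ?thesis by (auto simp: \<zeta>_def DeMoivre mult_ac)
  qed
  then obtain e where e: "\<And>j. j \<in> A \<Longrightarrow> z j = \<zeta> ^ e j" by metis
  define f :: "int poly" where "f = (\<Sum>j\<in>A. monom 1 (e j))"
  have f: "ipoly f (\<zeta> ^ m) = (\<Sum>j\<in>A. z j ^ m)" for m
    unfolding f_def by (simp add: e mult.commute flip: power_mult)
  have pow: "(\<Sum>j\<in>A. z j ^ m) = 0" if m: "m > 0" "m \<le> card A" for m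
  proof -
    have "coprime m d"
    proof (rule ccontr)
      assume "\<not> coprime m d"
      then obtain p where p: "prime p" "p dvd gcd m d"
        by (metis coprime_iff_gcd_eq_1 prime_factor_nat)
      then have "p \<le> m" using m(1) by (auto intro: dvd_imp_le)
      then show False using big[of p] p m(2) by auto
    qed
    from conjugate_root_of_unity[OF \<zeta> d m(1) this, of f] sum0 f[of 1] f[of m] show ?thesis by simp
  qed
  obtain i where i: "i \<in> A" using A by blast
  have "prime_ideal {0 :: complex}" by (simp add: prime_ideal_def)
  from vandermonde_mod_prime[OF this A(1) i, of z z] pow
  have "(\<Sum>j | j \<in> A \<and> z j - z i = 0. z j) = 0" by (simp flip: power_Suc)
  moreover have "(\<Sum>j | j \<in> A \<and> z j - z i = 0. z j) = of_nat (card {j \<in> A. z j - z i = 0}) * z i"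
    by simp
  moreover have "z i \<noteq> 0" using z[OF i] d by (auto simp: power_0_left)
  moreover have "card {j \<in> A. z j - z i = 0} \<noteq> 0" using A i by auto
  ultimately show False by simp
qed

section \<open>The grading of the polynomial ring\<close>

abbreviation "lookup \<equiv> Poly_Mapping.lookup"
abbreviation "keys \<equiv> Poly_Mapping.keys"

definition mono_degree :: "('n::finite \<Rightarrow>\<^sub>0 nat) \<Rightarrow> nat" where
  "mono_degree t = (\<Sum>i\<in>UNIV. lookup t i)"

lemma mono_degree_add: "mono_degree (s + t) = mono_degree s + mono_degree t"
  by (simp add: mono_degree_def lookup_add sum.distrib)

lemma mono_degree_single: "mono_degree (Poly_Mapping.single i k) = k"
  by (simp add: mono_degree_def lookup_single when_def)

definition homogeneous :: "nat \<Rightarrow> ('n::finite, 'a::comm_ring_1) mpoly_ring \<Rightarrow> bool" where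
  "homogeneous m f \<longleftrightarrow> (\<forall>t\<in>keys f. mono_degree t = m)"

definition hom_part :: "nat \<Rightarrow> ('n::finite, 'a::comm_ring_1) mpoly_ring \<Rightarrow> ('n, 'a) mpoly_ring" where
  "hom_part e f = Poly_Mapping.mapp (\<lambda>t c. c when mono_degree t = e) f"

lemma lookup_hom_part: "lookup (hom_part e f) t = (lookup f t when mono_degree t = e)"
  by (auto simp: hom_part_def lookup_mapp when_def in_keys_iff)

lemma homogeneous_hom_part: "homogeneous e (hom_part e f)"
  by (auto simp: homogeneous_def in_keys_iff lookup_hom_part when_def split: if_splits)

lemma hom_part_homogeneous: "homogeneous m f \<Longrightarrow> hom_part e f = (if e = m then f else 0)"
  by (rule poly_mapping_eqI) (auto simp: lookup_hom_part homogeneous_def in_keys_iff when_def)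

lemma hom_part_0 [simp]: "hom_part e 0 = 0"
  by (rule poly_mapping_eqI) (simp add: lookup_hom_part)

lemma hom_part_add: "hom_part e (f + g) = hom_part e f + hom_part e g"
  by (rule poly_mapping_eqI) (simp add: lookup_hom_part lookup_add when_def)

lemma hom_part_diff: "hom_part e (f - g) = hom_part e f - hom_part e g"
  by (rule poly_mapping_eqI) (simp add: lookup_hom_part lookup_minus when_def)

lemma homogeneous_mult:
  assumes "homogeneous m f" "homogeneous k g"
  shows "homogeneous (m + k) (f * g)"
  unfolding homogeneous_def
proof
  fix t assume "t \<in> keys (f * g)"
  then obtain u v where "t = u + v" "u \<in> keys f" "v \<in> keys g" using keys_mult[of f g] by auto
  then show "mono_degree t = m + k" using assms by (simp add: homogeneous_def mono_degree_add)
qed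

lemma homogeneous_sum:
  "(\<And>j. j \<in> A \<Longrightarrow> homogeneous m (f j)) \<Longrightarrow> homogeneous m (\<Sum>j\<in>A. f j)"
  unfolding homogeneous_def using keys_sum[of f A] by blast

lemma homogeneous_power: "homogeneous m f \<Longrightarrow> homogeneous (m * k) (f ^ k)"
proof (induction k)
  case (Suc k)
  then show ?case using homogeneous_mult[of m f "m * k" "f ^ k"] by simp
qed (simp add: homogeneous_def mono_degree_def)

lemma homogeneous_var: "homogeneous 1 (var i)"
  by (simp add: homogeneous_def var_def mono_degree_single)

lemma homogeneous_power_sum: "homogeneous m (power_sum m)"
  unfolding power_sum_def using homogeneous_power[OF homogeneous_var, of m]
  by (intro homogeneous_sum) simp

lemma hom_part_mult:
  assumes "homogeneous m h"
  shows "hom_part e (f * h) = (if m \<le> e then hom_part (e - m) f * h else 0)"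
proof (cases "m \<le> e")
  case True
  let ?g = "f - hom_part (e - m) f"
  have "hom_part e (?g * h) = 0"
  proof (rule poly_mapping_eqI)
    fix t
    show "lookup (hom_part e (?g * h)) t = lookup 0 t"
    proof (rule ccontr)
      assume "\<not> ?thesis"
      then have t: "t \<in> keys (?g * h)" "mono_degree t = e"
        by (auto simp: lookup_hom_part in_keys_iff when_def split: if_splits)
      from t(1) obtain u v where "t = u + v" "u \<in> keys ?g" "v \<in> keys h" using keys_mult[of ?g h] by auto
      then show False using t(2) assms True
        by (auto simp: homogeneous_def mono_degree_add in_keys_iff lookup_minus lookup_hom_part when_def split: if_splits)
    qed
  qed
  moreover have "hom_part e (hom_part (e - m) f * h) = hom_part (e - m) f * h"
    using homogeneous_mult[OF homogeneous_hom_part assms, of "e - m" f] True by (simp add: hom_part_homogeneous)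
  moreover have "f * h = hom_part (e - m) f * h + ?g * h" by (simp add: algebra_simps)
  ultimately show ?thesis using True by (metis add.right_neutral hom_part_add)
next
  case False
  have "lookup (hom_part e (f * h)) t = lookup 0 t" for t
  proof (rule ccontr)
    assume "\<not> ?thesis"
    then have t: "t \<in> keys (f * h)" "mono_degree t = e"
      by (auto simp: lookup_hom_part in_keys_iff when_def split: if_splits)
    from t(1) obtain u v where "t = u + v" "u \<in> keys f" "v \<in> keys h" using keys_mult[of f h] by auto
    then show False using t(2) assms False by (auto simp: homogeneous_def mono_degree_add)
  qed
  then show ?thesis using False by (simp add: poly_mapping_eqI)
qed

lemma sum_hom_parts: "f = (\<Sum>e\<in>mono_degree ` keys f. hom_part e f)"
proof (rule poly_mapping_eqI)
  fix t
  show "lookup f t = lookup (\<Sum>e\<in>mono_degree ` keys f. hom_part e f) t"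
    by (auto simp: lookup_sum lookup_hom_part when_def in_keys_iff sum.delta)
qed

text \<open>A component of a multiple \<open>c g\<close> of a homogeneous generator is a multiple of \<open>g\<close> by a component of \<open>c\<close>.\<close>

lemma hom_part_in_ideal_gen:
  assumes G: "\<And>g. g \<in> G \<Longrightarrow> \<exists>m. homogeneous m g" and "f \<in> ideal_gen G"
  shows "hom_part e f \<in> ideal_gen G"
  using assms(2)
proof (induction rule: ideal.span_induct_alt)
  case (step c g f)
  obtain m where "homogeneous m g" using G step.hyps by blast
  then have "hom_part e (c * g) = 0 \<or> hom_part e (c * g) = hom_part (e - m) c * g"
    by (auto simp: hom_part_mult)
  then have "hom_part e (c * g) \<in> ideal_gen G"
    using ideal.span_scale[OF ideal.span_base[OF step.hyps(1)], of "hom_part (e - m) c"] ideal.span_zero[of G]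
    by auto
  then show ?case using step.IH by (simp add: hom_part_add ideal.span_add)
qed (simp add: ideal.span_zero)

text \<open>If \<open>f, g\<close> is regular modulo \<open>G\<close>, then so is \<open>g, f\<close>. The first conclusion rests on the grading: from
  \<open>g u \<in> (G)\<close> one gets \<open>u = f v\<close> modulo \<open>G\<close> with \<open>g v \<in> (G)\<close> again, and for homogeneous \<open>u\<close> the degree
  of \<open>v\<close> can be taken to be smaller because \<open>f\<close> has positive degree.\<close>

lemma swap_nonzerodivisors:
  fixes f g :: "('n::finite, 'a::comm_ring_1) mpoly_ring"
  assumes G: "\<And>h. h \<in> G \<Longrightarrow> \<exists>m. homogeneous m h"
    and f: "homogeneous m f" "m > 0" and g: "homogeneous l g"
    and nf: "nonzerodivisor_mod (ideal_gen G) f"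
    and ng: "nonzerodivisor_mod (ideal_gen (insert f G)) g"
  shows "nonzerodivisor_mod (ideal_gen G) g"
    and "nonzerodivisor_mod (ideal_gen (insert g G)) f"
proof -
  let ?J = "ideal_gen G"
  have J: "ideal.subspace ?J" by simp
  have hom: "u \<in> ?J" if "homogeneous e u" "g * u \<in> ?J" for e u
    using that
  proof (induction e arbitrary: u rule: less_induct)
    case (less e)
    have "g * u \<in> ideal_gen (insert f G)"
      using less.prems(2) ideal.span_mono[of G "insert f G"] by blast
    then have "u \<in> ideal_gen (insert f G)" using ng by (simp add: nonzerodivisor_mod_def)
    then obtain r where r: "u - r * f \<in> ?J" by (auto simp: ideal.span_breakdown_eq ideal.span_insert)
    have "hom_part e (u - r * f) \<in> ?J" using hom_part_in_ideal_gen[OF G r] by blast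
    then have *: "u - hom_part e (r * f) \<in> ?J"
      using less.prems(1) by (simp add: hom_part_diff hom_part_homogeneous)
    show ?case
    proof (cases "m \<le> e")
      case False
      then show ?thesis using * f by (simp add: hom_part_mult)
    next
      case True
      \<comment> \<open>Only this component of \<open>r\<close> contributes to the component of \<open>r * f\<close> in the degree of \<open>u\<close>.\<close>
      let ?v = "hom_part (e - m) r"
      have uv: "u - ?v * f \<in> ?J" using * f True by (simp add: hom_part_mult)
      have "g * u - f * (g * ?v) \<in> ?J"
        using ideal.subspace_scale[OF J uv, of g] by (simp add: algebra_simps)
      then have "f * (g * ?v) \<in> ?J" using ideal_congD[OF J] less.prems(2) by blast
      then have "g * ?v \<in> ?J" using nf by (simp add: nonzerodivisor_mod_def)
      then have "?v \<in> ?J" using less.IH[of "e - m" ?v] f True by (simp add: homogeneous_hom_part)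
      then have "?v * f \<in> ?J" by (rule ideal_mult_right[OF J])
      then show ?thesis using ideal_congD[OF J uv] by blast
    qed
  qed
  show "nonzerodivisor_mod ?J g"
    unfolding nonzerodivisor_mod_def
  proof (intro allI impI)
    fix u assume gu: "g * u \<in> ?J"
    have "hom_part e u \<in> ?J" for e
    proof -
      have "hom_part (e + l) (u * g) \<in> ?J"
        using gu by (intro hom_part_in_ideal_gen G) (simp_all add: mult.commute)
      then have "hom_part e u * g \<in> ?J" using g by (simp add: hom_part_mult)
      then have "g * hom_part e u \<in> ?J" by (simp only: mult.commute)
      then show ?thesis using hom homogeneous_hom_part by blast
    qed
    then have "(\<Sum>e\<in>mono_degree ` keys u. hom_part e u) \<in> ?J"
      by (intro ideal.span_sum) auto
    then show "u \<in> ?J" using sum_hom_parts[of u] by simp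
  qed
  show "nonzerodivisor_mod (ideal_gen (insert g G)) f"
    unfolding nonzerodivisor_mod_def
  proof (intro allI impI)
    fix u assume "f * u \<in> ideal_gen (insert g G)"
    then obtain k where k: "f * u - k * g \<in> ?J" by (auto simp: ideal.span_insert)
    have "f * u - k * g \<in> ideal_gen (insert f G)"
      using k ideal.span_mono[of G "insert f G"] by blast
    moreover have "f * u \<in> ideal_gen (insert f G)"
      by (intro ideal_mult_right ideal.span_base) simp_all
    ultimately have "g * k \<in> ideal_gen (insert f G)"
      using ideal_congD[OF ideal.subspace_span] by (metis mult.commute)
    then have "k \<in> ideal_gen (insert f G)" using ng by (simp add: nonzerodivisor_mod_def)
    then obtain r where r: "k - r * f \<in> ?J" by (auto simp: ideal.span_insert)
    have "(f * u - k * g) + g * (k - r * f) \<in> ?J"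
      by (intro ideal.subspace_add[OF J] ideal.subspace_scale[OF J] k r)
    moreover have "(f * u - k * g) + g * (k - r * f) = f * (u - r * g)" by (simp add: algebra_simps)
    ultimately have "u - r * g \<in> ?J" using nf by (simp add: nonzerodivisor_mod_def)
    then show "u \<in> ideal_gen (insert g G)" by (auto simp: ideal.span_insert)
  qed
qed

section \<open>Ideals generated by variables\<close>

lemma sum_singles: "(\<Sum>t\<in>keys f. Poly_Mapping.single t (lookup f t)) = f"
  by (rule poly_mapping_eqI) (auto simp: lookup_sum lookup_single when_def in_keys_iff sum.delta)

lemma ideal_gen_var_iff:
  "f \<in> ideal_gen (var ` W) \<longleftrightarrow> (\<forall>t\<in>keys f. \<exists>i\<in>W. lookup t i > 0)"
proof
  show "\<forall>t\<in>keys f. \<exists>i\<in>W. lookup t i > 0" if "f \<in> ideal_gen (var ` W)"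
    using that
  proof (induction rule: ideal.span_induct_alt)
    case (step c x f)
    then obtain i where i: "i \<in> W" "x = var i" by blast
    show ?case
    proof
      fix t assume "t \<in> keys (c * x + f)"
      then have "t \<in> keys (c * x) \<or> t \<in> keys f" using keys_add[of "c * x" f] by blast
      then show "\<exists>i\<in>W. lookup t i > 0"
      proof
        assume "t \<in> keys (c * x)"
        then obtain u v where "t = u + v" "v \<in> keys x" using keys_mult[of c x] by auto
        then have "lookup t i > 0" by (auto simp: i(2) var_def lookup_add split: if_splits)
        then show ?thesis using i(1) by blast
      qed (use step.IH in blast)
    qed
  qed simp
next
  assume *: "\<forall>t\<in>keys f. \<exists>i\<in>W. lookup t i > 0"
  have "f = (\<Sum>t\<in>keys f. Poly_Mapping.single t (lookup f t))" by (rule sum_singles[symmetric])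
  also have "\<dots> \<in> ideal_gen (var ` W)"
  proof (rule ideal.span_sum)
    fix t assume "t \<in> keys f"
    then obtain i where i: "i \<in> W" "lookup t i > 0" using * by blast
    have "t = (t - Poly_Mapping.single i 1) + Poly_Mapping.single i 1"
      using i(2) by (intro poly_mapping_eqI) (auto simp: lookup_add lookup_minus lookup_single when_def)
    then have "Poly_Mapping.single t (lookup f t) = Poly_Mapping.single (t - Poly_Mapping.single i 1) (lookup f t) * var i"
      by (simp add: var_def mult_single)
    then show "Poly_Mapping.single t (lookup f t) \<in> ideal_gen (var ` W)"
      using i(1) by (auto intro: ideal.span_scale ideal.span_base)
  qed
  finally show "f \<in> ideal_gen (var ` W)" .
qed

lemma lookup_var_mult: "lookup (var i * f) (Poly_Mapping.single i 1 + t) = lookup f t"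
proof -
  have "f = (\<Sum>s\<in>keys f. Poly_Mapping.single s (lookup f s))" by (rule sum_singles[symmetric])
  then have "var i * f = (\<Sum>s\<in>keys f. Poly_Mapping.single (Poly_Mapping.single i 1 + s) (lookup f s))"
    by (metis (no_types, lifting) var_def mult_single mult_1 sum.cong sum_distrib_left)
  then show ?thesis by (auto simp: lookup_sum lookup_single when_def in_keys_iff sum.delta)
qed

lemma var_nonzerodivisor_mod_vars:
  assumes "i \<notin> W"
  shows "nonzerodivisor_mod (ideal_gen (var ` W)) (var i)"
  unfolding nonzerodivisor_mod_def ideal_gen_var_iff
proof (intro allI impI ballI)
  fix g t assume *: "\<forall>t\<in>keys (var i * g). \<exists>i\<in>W. lookup t i > 0" and t: "t \<in> keys g"
  have "Poly_Mapping.single i 1 + t \<in> keys (var i * g)"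
    using t unfolding in_keys_iff lookup_var_mult .
  then obtain j where "j \<in> W" "lookup (Poly_Mapping.single i 1 + t) j > 0" using * by blast
  then show "\<exists>i\<in>W. lookup t i > 0" using assms by (auto simp: lookup_add lookup_single when_def split: if_splits)
qed

section \<open>Roots of unity modulo a prime ideal\<close>

abbreviation const :: "complex \<Rightarrow> ('n, complex) mpoly_ring" where
  "const \<equiv> Poly_Mapping.single 0"

lemma const_mult: "const (a * b) = const a * const b"
  by (simp add: mult_single)

lemma const_power: "const (a ^ k) = const a ^ k"
  by (induction k) (simp_all add: const_mult)

lemma const_sum: "const (\<Sum>j\<in>A. f j) = (\<Sum>j\<in>A. const (f j))"
  by (induction A rule: infinite_finite_induct) (simp_all add: single_add)

lemma const_notin_prime_ideal:
  assumes "prime_ideal P" "c \<noteq> 0"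
  shows "const c \<notin> P"
proof
  assume "const c \<in> P"
  then have "const (inverse c) * const c \<in> P" using assms(1) by (simp add: prime_ideal_def ideal.subspace_scale)
  then show False using assms by (simp add: prime_ideal_def mult_single)
qed

lemma degree_prod_linear_le: "degree (\<Prod>w\<in>#A. [:- w, 1:]) \<le> size A"
proof (induction A)
  case (add w A)
  show ?case using degree_mult_le[of "[:- w, 1:]" "\<Prod>w\<in>#A. [:- w, 1:]"] add.IH by simp
qed simp

text \<open>The sum is the homogenization of \<open>\<Prod>\<^sub>w (X - w)\<close> evaluated at \<open>x\<close> and \<open>y\<close>, that is
  \<open>\<Prod>\<^sub>w (x - w y)\<close>. Splitting off one linear factor at a time lets primality apply at each step.\<close>

lemma homogenized_prod_in_prime_ideal:
  fixes x y :: "('n, complex) mpoly_ring"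
  assumes P: "prime_ideal P"
    and "(\<Sum>k\<le>size A. const (coeff (\<Prod>w\<in>#A. [:- w, 1:]) k) * x ^ k * y ^ (size A - k)) \<in> P"
  shows "\<exists>w\<in>#A. x - const w * y \<in> P"
  using assms(2)
proof (induction A)
  case empty
  then show ?case using P by (simp add: prime_ideal_def)
next
  case (add w A)
  let ?p = "\<Prod>w\<in>#A. [:- w, 1:]" and ?n = "size A"
  let ?H = "\<Sum>k\<le>?n. const (coeff ?p k) * x ^ k * y ^ (?n - k)"
  have top: "coeff ?p (Suc ?n) = 0"
    using degree_prod_linear_le[of A] by (intro coeff_eq_0) simp
  have "(\<Sum>k\<le>Suc ?n. const (coeff (\<Prod>w\<in>#add_mset w A. [:- w, 1:]) k) * x ^ k * y ^ (Suc ?n - k))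
      = (\<Sum>k\<le>Suc ?n. const (coeff (pCons 0 ?p) k) * x ^ k * y ^ (Suc ?n - k))
        - (\<Sum>k\<le>Suc ?n. const (w * coeff ?p k) * x ^ k * y ^ (Suc ?n - k))"
    unfolding sum_subtractf[symmetric]
    by (intro sum.cong refl) (simp add: single_diff algebra_simps)
  also have "(\<Sum>k\<le>Suc ?n. const (coeff (pCons 0 ?p) k) * x ^ k * y ^ (Suc ?n - k)) = x * ?H"
    by (subst sum.atMost_Suc_shift) (simp add: sum_distrib_left mult_ac)
  also have "(\<Sum>k\<le>Suc ?n. const (w * coeff ?p k) * x ^ k * y ^ (Suc ?n - k)) = const w * y * ?H"
    by (simp add: top sum_distrib_left const_mult Suc_diff_le mult_ac)
  also have "x * ?H - const w * y * ?H = (x - const w * y) * ?H" by (simp only: left_diff_distrib)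
  finally have "(x - const w * y) * ?H \<in> P" using add.prems by simp
  then have "x - const w * y \<in> P \<or> ?H \<in> P" using P unfolding prime_ideal_def by blast
  then show ?case using add.IH by auto
qed

lemma root_of_unity_mod_prime_ideal:
  fixes x y :: "('n, complex) mpoly_ring"
  assumes P: "prime_ideal P" and d: "d > 0" and xy: "x ^ d - y ^ d \<in> P"
  obtains w where "w ^ d = 1" "x - const w * y \<in> P"
proof -
  let ?u = "monom 1 d - 1 :: complex poly"
  have deg: "degree ?u = d"
  proof (rule antisym)
    show "degree ?u \<le> d" by (intro degree_diff_le degree_monom_le) simp
    show "d \<le> degree ?u" using d by (intro le_degree) simp
  qed
  have lc: "lead_coeff ?u = 1" unfolding deg using d by simp
  have "?u \<noteq> 0" using deg d by auto
  then obtain A where A: "size A = d" "?u = (\<Prod>w\<in>#A. [:- w, 1:])"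
    using alg_closed_imp_factorization[of ?u] unfolding deg lc[unfolded deg] by auto
  have "(\<Sum>k\<le>d. const (coeff ?u k) * x ^ k * y ^ (d - k))
      = (\<Sum>k\<in>{0, d}. const (coeff ?u k) * x ^ k * y ^ (d - k))"
    by (rule sum.mono_neutral_right) (auto simp: coeff_1)
  also have "\<dots> = x ^ d - y ^ d" using d by (simp add: single_uminus)
  finally have "(\<Sum>k\<le>d. const (coeff ?u k) * x ^ k * y ^ (d - k)) \<in> P" using xy by simp
  then obtain w where w: "w \<in># A" "x - const w * y \<in> P"
    using homogenized_prod_in_prime_ideal[OF P, of A x y] unfolding A(1) A(2)[symmetric] by blast
  have "poly ?u w = 0"
    unfolding A(2) poly_prod_mset using w(1) by (auto simp: prod_mset_zero_iff)
  then have "w ^ d = 1" by (simp add: poly_monom)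
  then show thesis using that w(2) by blast
qed

section \<open>Regularity of power sums\<close>

text \<open>Modulo this ideal the variables outside \<open>U\<close> are zero, so it describes the first \<open>k\<close> power sums in the
  variables from \<open>U\<close> alone. Keeping one ring for all \<open>U\<close> makes an induction on the number of variables
  possible although the index type is fixed.\<close>

definition power_sum_gens ::
    "nat \<Rightarrow> nat \<Rightarrow> nat \<Rightarrow> 'n::finite set \<Rightarrow> ('n, complex) mpoly_ring set" where
  "power_sum_gens a d k U = (\<lambda>j. power_sum (a + j * d)) ` {..<k} \<union> var ` (- U)"

lemma homogeneous_power_sum_gens: "g \<in> power_sum_gens a d k U \<Longrightarrow> \<exists>m. homogeneous m g"
  using homogeneous_power_sum homogeneous_var by (auto simp: power_sum_gens_def)

lemma power_sum_gens_Suc: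
  "power_sum_gens a d (Suc k) U = insert (power_sum (a + k * d)) (power_sum_gens a d k U)"
  by (auto simp: power_sum_gens_def lessThan_Suc)

lemma power_sum_gens_insert:
  "i \<notin> U \<Longrightarrow> power_sum_gens a d k U = insert (var i) (power_sum_gens a d k (insert i U))"
  by (auto simp: power_sum_gens_def)

text \<open>It suffices that every prime ideal \<open>P\<close> above the ideal contains \<open>x\<^sub>i\<close>. Modulo \<open>P\<close> the variables with
  the same \<open>d\<close>-th power as \<open>x\<^sub>i\<close> are multiples of \<open>x\<^sub>i\<close> by \<open>d\<close>-th roots of unity, and the Vandermonde
  argument shows that their \<open>a\<close>-th powers add up to zero. This sum is \<open>x\<^sub>i\<^sup>a\<close> times a sum of at most
  \<open>card U\<close> many \<open>d\<close>-th roots of unity, which is a non-zero constant.\<close>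

lemma var_power_in_power_sum_ideal:
  fixes U :: "'n::finite set"
  assumes "a > 0" "d > 0" and i: "i \<in> U"
    and big: "\<And>p. prime p \<Longrightarrow> p dvd d \<Longrightarrow> card U < p"
  shows "\<exists>N. var i ^ N \<in> ideal_gen (power_sum_gens a d (card U) U)"
proof (rule ccontr)
  let ?J = "ideal_gen (power_sum_gens a d (card U) U)"
  assume "\<not> ?thesis"
  then obtain P where P: "prime_ideal P" and JP: "?J \<subseteq> P" and iP: "var i \<notin> P"
    using exists_prime_ideal_avoiding_powers[of ?J "var i"] by auto
  have sP: "ideal.subspace P" using P by (simp add: prime_ideal_def)
  have GP: "power_sum_gens a d (card U) U \<subseteq> P" using JP ideal.span_superset by blast
  have "(\<Sum>j\<in>U. var j ^ a * (var j ^ d) ^ k) \<in> P" if "k < card U" for k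
  proof -
    have "(\<Sum>j\<in>- U. var j ^ (a + k * d)) \<in> P"
    proof (rule ideal.subspace_sum[OF sP])
      fix j assume "j \<in> - U"
      then have "var j \<in> P" using GP by (auto simp: power_sum_gens_def)
      moreover have "var j ^ (a + k * d) = var j * var j ^ (a + k * d - 1)"
        using \<open>a > 0\<close> by (metis add_gr_0 power_eq_if not_gr0)
      ultimately show "var j ^ (a + k * d) \<in> P" using ideal_mult_right[OF sP] by metis
    qed
    moreover have "power_sum (a + k * d) \<in> P" using GP that by (auto simp: power_sum_gens_def)
    moreover have "power_sum (a + k * d) = (\<Sum>j\<in>U. var j ^ (a + k * d)) + (\<Sum>j\<in>- U. var j ^ (a + k * d))"
      unfolding power_sum_def by (subst sum.union_disjoint[symmetric]) auto
    ultimately have "(\<Sum>j\<in>U. var j ^ (a + k * d)) \<in> P"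
      using ideal.subspace_diff[OF sP, of "power_sum (a + k * d)"] by (metis add_diff_cancel_right')
    then show ?thesis by (simp add: power_add power_mult mult.commute[of k d])
  qed
  from vandermonde_mod_prime[OF P _ i this]
  have sum_P: "(\<Sum>j | j \<in> U \<and> var j ^ d - var i ^ d \<in> P. var j ^ a) \<in> P" by simp
  define B where "B = {j \<in> U. var j ^ d - var i ^ d \<in> P}"
  have iB: "i \<in> B" using i ideal.subspace_0[OF sP] by (simp add: B_def)
  have "\<exists>w. w ^ d = 1 \<and> var j - const w * var i \<in> P" if "j \<in> B" for j
    using that root_of_unity_mod_prime_ideal[OF P \<open>d > 0\<close>, of "var j" "var i"] by (auto simp: B_def)
  then obtain w where w: "\<And>j. j \<in> B \<Longrightarrow> w j ^ d = 1" "\<And>j. j \<in> B \<Longrightarrow> var j - const (w j) * var i \<in> P"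
    by metis
  have "(\<Sum>j\<in>B. var j ^ a - const (w j ^ a) * var i ^ a) \<in> P"
  proof (rule ideal.subspace_sum[OF sP])
    fix j assume j: "j \<in> B"
    obtain r where "var j ^ a - (const (w j) * var i) ^ a = (var j - const (w j) * var i) * r"
      using power_diff_dvd by (rule dvdE)
    then show "var j ^ a - const (w j ^ a) * var i ^ a \<in> P"
      using ideal_mult_right[OF sP w(2)[OF j], of r] by (simp add: power_mult_distrib const_power)
  qed
  moreover have "(\<Sum>j\<in>B. var j ^ a - const (w j ^ a) * var i ^ a)
      = (\<Sum>j\<in>B. var j ^ a) - const (\<Sum>j\<in>B. w j ^ a) * var i ^ a"
    by (simp add: sum_subtractf sum_distrib_right const_sum)
  ultimately have "(\<Sum>j\<in>B. var j ^ a) - const (\<Sum>j\<in>B. w j ^ a) * var i ^ a \<in> P" by simp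
  then have "const (\<Sum>j\<in>B. w j ^ a) * var i ^ a \<in> P"
    using sum_P ideal_congD[OF sP] unfolding B_def by blast
  moreover have "(\<Sum>j\<in>B. w j ^ a) \<noteq> 0"
  proof (rule sum_few_roots_of_unity_nonzero)
    show "(w j ^ a) ^ d = 1" if "j \<in> B" for j
      using w(1)[OF that] by (metis power_mult mult.commute power_one)
    have "card B \<le> card U" by (rule card_mono) (auto simp: B_def)
    then show "card B < p" if "prime p" "p dvd d" for p using big[OF that] by simp
  qed (use iB \<open>d > 0\<close> in auto)
  ultimately have "var i ^ a \<in> P" using const_notin_prime_ideal[OF P] P unfolding prime_ideal_def by blast
  then show False using prime_ideal_power[OF P] iP by blast
qed

text \<open>Adding \<open>i\<close> to \<open>U\<close> removes \<open>x\<^sub>i\<close> from the generators, so the induction hypothesis says that every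
  \<open>p\<^sub>k\<close> with \<open>k < card U\<close> is a non-zero-divisor after \<open>x\<^sub>i, p\<^sub>0, \<dots>, p\<^sub>k\<^sub>-\<^sub>1\<close>. Swapping carries
  \<open>x\<^sub>i\<close> to the end, and the new last power sum takes its place.\<close>

lemma power_sum_nonzerodivisor:
  fixes U :: "'n::finite set"
  assumes a: "a > 0" and d: "d > 0"
    and big: "\<And>p. prime p \<Longrightarrow> p dvd d \<Longrightarrow> card U < p"
    and k: "k < card U"
  shows "nonzerodivisor_mod (ideal_gen (power_sum_gens a d k U)) (power_sum (a + k * d))"
  using finite[of U] big k
proof (induction U arbitrary: k rule: finite_induct)
  case (insert i U)
  let ?G = "\<lambda>k. power_sum_gens a d k (insert i U)"
  have IH: "nonzerodivisor_mod (ideal_gen (insert (var i) (?G k))) (power_sum (a + k * d))"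
    if "k < card U" for k
  proof -
    have "card U < p" if "prime p" "p dvd d" for p
      using insert.prems(1)[OF that] insert.hyps by simp
    from insert.IH[OF this that] show ?thesis
      using power_sum_gens_insert[OF insert.hyps(2)] by simp
  qed
  have var: "nonzerodivisor_mod (ideal_gen (?G k)) (var i)" if "k \<le> card U" for k
    using that
  proof (induction k)
    case 0
    show ?case using var_nonzerodivisor_mod_vars[of i "- insert i U"] by (simp add: power_sum_gens_def)
  next
    case (Suc k)
    show ?case unfolding power_sum_gens_Suc
      by (rule swap_nonzerodivisors(2)[OF homogeneous_power_sum_gens homogeneous_var _ homogeneous_power_sum])
        (use Suc IH in auto)
  qed
  show ?case
  proof (cases "k < card U")
    case True
    show ?thesis
      by (rule swap_nonzerodivisors(1)[OF homogeneous_power_sum_gens homogeneous_var _ homogeneous_power_sum])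
        (use True IH var in auto)
  next
    case False
    then have k: "k = card U" using insert by simp
    let ?p = "power_sum (a + k * d) :: ('n, complex) mpoly_ring"
    obtain N where N: "var i ^ N \<in> ideal_gen (power_sum_gens a d (card (insert i U)) (insert i U))"
      using var_power_in_power_sum_ideal[OF a d, of i "insert i U"] insert.prems(1) by auto
    have "var i ^ N \<in> ideal_gen (insert ?p (?G k))"
      using N insert.hyps by (simp add: k power_sum_gens_Suc)
    then show ?thesis
      using var[of k] k nonzerodivisor_mod_if_divides_power by blast
  qed
qed simp

theorem theorem2p4:
  fixes a d :: nat
  assumes "CARD('n::finite) \<ge> 2"
    and "a > 0" and "d > 0"
    and "gcd a d = 1"
    and "fact CARD('n) dvd (\<Prod>k<CARD('n). a + k * d)"
  shows "regular_sequence
    (map (\<lambda>k. power_sum (a + k * d) :: ('n, complex) mpoly_ring) [0..<CARD('n)])"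
proof -
  let ?n = "CARD('n)"
  let ?p = "\<lambda>k. power_sum (a + k * d) :: ('n, complex) mpoly_ring"
  have big: "?n < p" if p: "prime p" "p dvd d" for p
  proof (rule ccontr)
    assume "\<not> ?n < p"
    then have "p dvd fact ?n" using p(1) by (simp add: prime_dvd_fact_iff)
    then have "p dvd (\<Prod>k<?n. a + k * d)" using assms(5) dvd_trans by blast
    then obtain k where "p dvd a + k * d" using p(1) by (auto simp: prime_dvd_prod_iff)
    then have "p dvd a" using p(2) by (simp add: dvd_add_left_iff)
    then have "p dvd gcd a d" using p(2) by simp
    then show False using p(1) assms(4) by simp
  qed
  have "?p ` {..<?n} \<subseteq> ideal_gen (range var)"
  proof clarify
    fix k
    have "var i ^ (a + k * d) = var i ^ (a + k * d - 1) * (var i :: ('n, complex) mpoly_ring)" for i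
      using assms(2) by (metis add_gr_0 power_minus_mult)
    then show "?p k \<in> ideal_gen (range var)"
      unfolding power_sum_def by (intro ideal.span_sum) (metis ideal.span_base ideal.span_scale rangeI)
  qed
  then have "ideal_gen (?p ` {..<?n}) \<subseteq> ideal_gen (range var)"
    by (rule ideal.span_minimal) simp
  moreover have "1 \<notin> ideal_gen (range (var :: 'n \<Rightarrow> ('n, complex) mpoly_ring))"
    by (simp add: ideal_gen_var_iff)
  ultimately have "ideal_gen (?p ` {..<?n}) \<noteq> UNIV" by blast
  moreover have "nonzerodivisor_mod (ideal_gen (?p ` {..<k})) (?p k)" if "k < ?n" for k
    using power_sum_nonzerodivisor[OF assms(2,3), of "UNIV :: 'n set"] big that
    by (simp add: power_sum_gens_def)
  ultimately show ?thesis
    by (simp add: regular_sequence_def take_map atLeast0LessThan)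
qed

end
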